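(* Let $n\ge1$ be an integer and let $$m^*(n):=\max_{\omega_n\in\Omega_n}\ \min_{1\le j\le n}\ \max_{t\in[t_j,t_{j+1}]}\left|\prod_{k=1}^n (e^{it}-z_k)\right|,\qquad z_k=e^{it_k}.$$ Then $m^*(n)=2$, and this maximum is attained only for $n$ distinct equally spaced points $\{z_1,\ldots,z_n\}$ on the unit circle.
   Context: $\Omega_n$ denotes the collection of all $n$-tuples $\omega_n=(t_1,\ldots,t_n)\in[0,2\pi)^n$ with $0\le t_1\le\cdots\le t_n<2\pi$ (coincident points are allowed), and $t_{n+1}:=t_1+2\pi$. *)

theory Defs
  imports "HOL-Analysis.Analysis"
begin

definition Omega :: "nat \<Rightarrow> (nat \<Rightarrow> real) set" where
  "Omega n = {t \<in> {1..n} \<rightarrow>\<^sub>E {0..<2*pi}. mono_on {1..n} t}"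

text \<open>The maximum of a set of reals that may be infinite (\<^const>\<open>Max\<close> is only meaningful
  on finite sets). It is unspecified if the set has no greatest element.\<close>
definition maximum :: "real set \<Rightarrow> real" where
  "maximum S = (GREATEST x. x \<in> S)"

text \<open>The tuple extended by the convention $t_{n+1} = t_1 + 2\pi$.\<close>
definition node :: "nat \<Rightarrow> (nat \<Rightarrow> real) \<Rightarrow> nat \<Rightarrow> real" where
  "node n t j = (if j = n + 1 then t 1 + 2*pi else t j)"

definition arc_max :: "nat \<Rightarrow> (nat \<Rightarrow> real) \<Rightarrow> nat \<Rightarrow> real" where
  "arc_max n t j =
     maximum ((\<lambda>s. norm (\<Prod>k=1..n. (cis s - cis (t k)))) ` {node n t j..node n t (j + 1)})"

definition min_arc_max :: "nat \<Rightarrow> (nat \<Rightarrow> real) \<Rightarrow> real" where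
  "min_arc_max n t = Min (arc_max n t ` {1..n})"

definition m_star :: "nat \<Rightarrow> real" where
  "m_star n = maximum (min_arc_max n ` Omega n)"

definition distinct_equally_spaced :: "nat \<Rightarrow> (nat \<Rightarrow> complex) \<Rightarrow> bool" where
  "distinct_equally_spaced n z \<longleftrightarrow>
     inj_on z {1..n} \<and>
     (\<exists>a::real. z ` {1..n} = (\<lambda>k. cis (a + 2 * pi * real k / real n)) ` {1..n})"

end

theory Submission
  imports Defs "HOL-Computational_Algebra.Polynomial"
begin

text \<open>
  Let $P(z) = \prod_k (z - z_k)$ and suppose that every arc contains a point $\zeta_j = e^{is_j}$
  with $|P(\zeta_j)| \ge 2$. Put $c = -P(0)$, so that $|c| = 1$, $P(z) - (z^n - c) = z\,p(z)$ with
  $\deg p \le n - 2$, and $|z^n - c| \le 2$ on the circle. Hence the divided difference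
  $\sum_j p(\zeta_j) / \prod_{k \ne j} (\zeta_j - \zeta_k)$ vanishes. On the circle, up to a common
  phase, $P$ and $z^n - c$ are real trigonometric functions, and the signs of $P(\zeta_j)$ and of
  $\prod_{k \ne j} \sin ((s_j - s_k)/2)$ agree because the $t_k$ and $s_k$ interlace. So all
  terms of the sum are nonnegative multiples of one number and must vanish, whence
  $P(z) = z^n - c$, with $n$ distinct roots.
\<close>

section \<open>Polynomials determined by their values at finitely many points\<close>

text \<open>The left-hand side is the divided difference of \<^term>\<open>p\<close> at the points of \<^term>\<open>S\<close>,
  that is, the top coefficient of the Lagrange interpolant.\<close>
lemma sum_poly_over_node_differences:
  fixes p :: "'a :: field poly"
  assumes "finite S" "degree p < card S"
  shows "(\<Sum>x\<in>S. poly p x / (\<Prod>y\<in>S-{x}. x - y)) = coeff p (card S - 1)"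
proof -
  define B where "B x = (\<Prod>y\<in>S-{x}. [:-y, 1:])" for x
  define w where "w x = poly p x / (\<Prod>y\<in>S-{x}. x - y)" for x
  define L where "L = (\<Sum>x\<in>S. smult (w x) (B x))"
  have deg_B: "degree (B x) = card S - 1" if "x \<in> S" for x
    unfolding B_def using that by (subst degree_prod_eq_sum_degree) auto
  have lc_B: "coeff (B x) (card S - 1) = 1" if "x \<in> S" for x
    using lead_coeff_prod[of "\<lambda>y. [:-y, 1:]" "S - {x}"] deg_B[OF that] by (simp add: B_def)
  have "p = L"
  proof (rule poly_eqI_degree)
    fix x assume x: "x \<in> S"
    have "poly (B y) x = 0" if "y \<in> S" "y \<noteq> x" for y
      unfolding B_def poly_prod using assms that x by (intro prod_zero) auto
    hence "poly L x = w x * poly (B x) x"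
      unfolding L_def poly_sum using assms x by (subst sum.remove[of _ x]) auto
    also have "\<dots> = poly p x"
      using assms by (simp add: w_def B_def poly_prod)
    finally show "poly p x = poly L x" by simp
  next
    have "degree L \<le> card S - 1"
      unfolding L_def by (intro degree_sum_le) (use assms deg_B degree_smult_le in auto)
    thus "card S > degree L" using assms by linarith
  qed (use assms in auto)
  hence "coeff p (card S - 1) = coeff L (card S - 1)" by simp
  also have "\<dots> = (\<Sum>x\<in>S. w x)"
    unfolding L_def coeff_sum coeff_smult by (intro sum.cong refl) (metis lc_B mult.right_neutral)
  finally show ?thesis by (simp add: w_def)
qed

text \<open>Since \<open>A\<close> is nonempty, both sides are monic of degree
  \<open>card A\<close>. Their difference has smaller degree, so agreement on \<open>card A\<close>
  points already makes them equal as polynomials.\<close>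

lemma poly_prod_linear_eq_power_minus:
  fixes z :: "'i \<Rightarrow> 'a :: field"
  assumes "finite A" "A \<noteq> {}" "card S \<ge> card A"
    and "\<And>x. x \<in> S \<Longrightarrow> (\<Prod>k\<in>A. x - z k) = x ^ card A - c"
  shows "(\<Prod>k\<in>A. x - z k) = x ^ card A - c"
proof -
  let ?P = "\<Prod>k\<in>A. [:- z k, 1:]" and ?M = "monom 1 (card A) - [:c:]"
  have n: "card A > 0" using assms by (simp add: card_gt_0_iff)
  have deg: "degree ?P = card A" by (subst degree_prod_eq_sum_degree) auto
  have "?P = ?M"
  proof (rule poly_eqI_degree_lead_coeff)
    have "coeff ?M (card A) = 1" using n by (cases "card A") auto
    thus "coeff ?P (card A) = coeff ?M (card A)"
      using lead_coeff_prod[of "\<lambda>k. [:- z k, 1:]" A] by (simp add: deg)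
    show "degree ?M \<le> card A"
      by (intro degree_diff_le) (auto simp: degree_monom_eq)
  qed (use assms deg in \<open>auto simp: poly_prod poly_monom\<close>)
  hence "poly ?P x = poly ?M x" by simp
  thus ?thesis by (simp add: poly_prod poly_monom)
qed

section \<open>Half-angle formulas: a real factor times a phase\<close>

text \<open>This is 2i sin((x - y)/2) e^(i(x + y)/2), with the factor i absorbed into the phase as
  the summand \<open>pi / 2\<close>. The remaining factor is real, so its sign can be followed
  through products.\<close>

lemma cis_diff: "cis x - cis y = of_real (2 * sin ((x - y) / 2)) * cis ((x + y + pi) / 2)"
proof -
  have 1: "cos ((x + y + pi) / 2) = - sin ((x + y) / 2)" "sin ((x + y + pi) / 2) = cos ((x + y) / 2)"
    by (simp_all add: add_divide_distrib cos_add sin_add)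
  have 2: "sin ((y - x) / 2) = - sin ((x - y) / 2)"
    by (metis minus_diff_eq minus_divide_left sin_minus)
  show ?thesis
    by (rule complex_eqI) (simp_all add: 1 2 cos_diff_cos sin_diff_sin)
qed

lemma cis_add: "cis x + cis y = of_real (2 * cos ((x - y) / 2)) * cis ((x + y) / 2)"
  by (rule complex_eqI) (auto simp: cos_plus_cos sin_plus_sin)

lemma prod_cis: "(\<Prod>k\<in>A. cis (f k)) = cis (\<Sum>k\<in>A. f k)"
  by (induction A rule: infinite_finite_induct) (auto simp: cis_mult)

lemma prod_cis_diff:
  "(\<Prod>k\<in>A. cis x - cis (f k)) =
     of_real (\<Prod>k\<in>A. 2 * sin ((x - f k) / 2)) * cis ((card A * (x + pi) + sum f A) / 2)"
proof -
  have "(\<Sum>k\<in>A. (x + f k + pi) / 2) = (card A * (x + pi) + sum f A) / 2"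
    by (simp add: sum.distrib algebra_simps flip: sum_divide_distrib)
  thus ?thesis by (simp only: cis_diff[of x] prod.distrib[of "\<lambda>k. complex_of_real (_ k)"] prod_cis of_real_prod)
qed

section \<open>Rigidity for interlacing points\<close>

text \<open>The factors for the same k are paired: for k < j both sines have arguments in (0, pi),
  for k > j both have arguments in (-pi, 0). The unpaired factor, with k = j in the first product,
  is positive by itself.\<close>

lemma interlacing_prod_sin_pos:
  fixes s t :: "'i :: linorder \<Rightarrow> real"
  assumes "finite A" "j \<in> A"
    and "t j < s j" "s j < t j + 2 * pi"
    and "\<And>k. k \<in> A \<Longrightarrow> k < j \<Longrightarrow> t k < s j \<and> s j < t k + 2 * pi \<and> s k < s j \<and> s j < s k + 2 * pi"
    and "\<And>k. k \<in> A \<Longrightarrow> k > j \<Longrightarrow> s j < t k \<and> t k < s j + 2 * pi \<and> s j < s k \<and> s k < s j + 2 * pi"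
  shows "(\<Prod>k\<in>A. 2 * sin ((s j - t k) / 2)) * (\<Prod>k\<in>A-{j}. 2 * sin ((s j - s k) / 2)) > 0"
proof -
  have "(2 * sin ((s j - t k) / 2)) * (2 * sin ((s j - s k) / 2)) > 0" if "k \<in> A - {j}" for k
  proof (cases "k < j")
    case True
    with assms(5)[of k] that show ?thesis by (intro mult_pos_pos) (auto intro!: sin_gt_zero)
  next
    case False
    with that have "k > j" by auto
    with that assms(6)[of k] have "sin ((t k - s j) / 2) > 0" "sin ((s k - s j) / 2) > 0"
      by (auto intro!: sin_gt_zero)
    moreover have "sin ((s j - x) / 2) = - sin ((x - s j) / 2)" for x
      by (metis minus_diff_eq minus_divide_left sin_minus)
    ultimately show ?thesis by simp
  qed
  moreover have "2 * sin ((s j - t j) / 2) > 0"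
    using assms(3,4) by (auto intro!: sin_gt_zero)
  ultimately have "(2 * sin ((s j - t j) / 2)) *
      (\<Prod>k\<in>A-{j}. (2 * sin ((s j - t k) / 2)) * (2 * sin ((s j - s k) / 2))) > 0"
    by (intro mult_pos_pos[OF _ prod_pos])
  thus ?thesis
    unfolding prod.distrib[where A = "A - {j}"] prod.remove[OF assms(1,2), of "\<lambda>k. 2 * sin ((s j - t k) / 2)"]
    by (simp only: mult.assoc)
qed

text \<open>The bound 2 is assumed only weakly, so the conclusion describes the equality case. It
  therefore serves both for the upper bound on \<open>m_star\<close> and for the uniqueness of the
  maximizers.\<close>

lemma prod_eq_power_minus_if_interlacing:
  fixes s t :: "nat \<Rightarrow> real"
  assumes n: "n \<ge> 1"
    and self: "\<And>j. j \<in> {1..n} \<Longrightarrow> t j < s j \<and> s j < t j + 2 * pi"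
    and less: "\<And>j k. j \<in> {1..n} \<Longrightarrow> k \<in> {1..n} \<Longrightarrow> k < j \<Longrightarrow>
        t k < s j \<and> s j < t k + 2 * pi \<and> s k < s j \<and> s j < s k + 2 * pi \<and> s k < t j \<and> t j < s k + 2 * pi"
    and large: "\<And>j. j \<in> {1..n} \<Longrightarrow> norm (\<Prod>k=1..n. cis (s j) - cis (t k)) \<ge> 2"
  shows "\<exists>c. norm c = 1 \<and> (\<forall>z. (\<Prod>k=1..n. z - cis (t k)) = z ^ n - c)"
proof -
  let ?A = "{1..n}"
  \<comment> \<open>As -z_k = \<open>cis (t k + pi)\<close>, this is an argument of P(0). Twice the
    phase of P(\<open>cis (s j)\<close>) is then \<open>n * s j + \<theta>\<close>.\<close>
  define \<theta> where "\<theta> = sum t ?A + n * pi"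
  \<comment> \<open>\<open>T j\<close> and \<open>C j\<close> are the real factors of P(z) and z^n -
    c at z = \<open>cis (s j)\<close>, after removal of the phase that both share; for
    \<open>C\<close> this uses -c = \<open>cis \<theta>\<close>.\<close>
  define T where "T j = (\<Prod>k\<in>?A. 2 * sin ((s j - t k) / 2))" for j
  define C where "C j = 2 * cos ((n * s j - \<theta>) / 2)" for j
  define e where "e j = (\<Prod>k\<in>?A-{j}. 2 * sin ((s j - s k) / 2))" for j
  define c where "c = - cis \<theta>"
  define Q where "Q = (\<Prod>k\<in>?A. [:- cis (t k), 1:]) - monom 1 n + [:c:]"
  have Te: "T j * e j > 0" if "j \<in> ?A" for j
    unfolding T_def e_def using that self[OF that] less
    by (intro interlacing_prod_sin_pos) auto
  have prod_T: "(\<Prod>k\<in>?A. cis (s j) - cis (t k)) = of_real (T j) * cis ((n * s j + \<theta>) / 2)" for j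
    by (simp add: prod_cis_diff T_def \<theta>_def algebra_simps)
  have ref_C: "cis (s j) ^ n - c = of_real (C j) * cis ((n * s j + \<theta>) / 2)" for j
    using cis_add[of "n * s j" \<theta>] Complex.DeMoivre[of "s j" n] by (simp only: c_def diff_minus_eq_add C_def)
  have poly_Q: "poly Q (cis (s j)) = of_real (T j - C j) * cis ((n * s j + \<theta>) / 2)" for j
  proof -
    have "poly Q (cis (s j)) = (\<Prod>k\<in>?A. cis (s j) - cis (t k)) - (cis (s j) ^ n - c)"
      by (simp add: Q_def poly_prod poly_monom)
    thus ?thesis unfolding prod_T ref_C by (simp only: of_real_diff left_diff_distrib)
  qed
  have "coeff Q 0 = 0"
  proof -
    have "poly Q 0 = (\<Prod>k\<in>?A. - cis (t k)) + c"
      using n by (simp add: Q_def poly_prod poly_monom)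
    also have "(\<Prod>k\<in>?A. - cis (t k)) = (\<Prod>k\<in>?A. cis (t k + pi))"
      by (simp add: cis_mult[symmetric])
    also have "\<dots> = cis \<theta>"
      by (simp add: prod_cis \<theta>_def sum.distrib)
    finally show ?thesis by (simp add: c_def poly_0_coeff_0)
  qed
  then obtain p where p: "Q = pCons 0 p" by (cases Q) auto
  have degP: "degree (\<Prod>k\<in>?A. [:- cis (t k), 1:]) = n"
    by (subst degree_prod_eq_sum_degree) auto
  have "degree Q \<le> n"
    unfolding Q_def by (intro degree_add_le degree_diff_le) (simp_all only: degP, auto simp: degree_monom_eq)
  moreover have "coeff Q n = 0"
  proof -
    have "coeff (\<Prod>k\<in>?A. [:- cis (t k), 1:]) n = 1"
      using lead_coeff_prod[of "\<lambda>k. [:- cis (t k), 1:]" ?A] unfolding degP by simp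
    moreover have "coeff [:c:] n = 0" using n by (cases n) auto
    ultimately show ?thesis by (simp only: Q_def coeff_add coeff_diff coeff_monom) simp
  qed
  \<comment> \<open>Both the leading and the constant terms cancel in \<open>Q\<close>. The result
    is put as a degree bound together with a vanishing coefficient because the divided difference at
    n points equals the coefficient of index n - 1; this also covers n = 1.\<close>
  ultimately have "degree p < n" "coeff p (n - 1) = 0"
    using n p by (auto simp: degree_pCons_eq_if coeff_pCons split: if_splits nat.splits)
  have inj: "inj_on (\<lambda>j. cis (s j)) ?A"
  proof (rule inj_onI, rule ccontr)
    fix j k assume jk: "j \<in> ?A" "k \<in> ?A" "cis (s j) = cis (s k)" "j \<noteq> k"
    have "sin ((s j - s k) / 2) = 0"
      using cis_diff[of "s j" "s k"] jk by simp
    hence "e j = 0" unfolding e_def using jk by (intro prod_zero) auto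
    thus False using Te[OF jk(1)] by simp
  qed
  let ?S = "(\<lambda>j. cis (s j)) ` ?A"
  have card_S: "card ?S = n" using inj by (simp add: card_image)
  \<comment> \<open>Dividing \<open>Q\<close> by z lowers the phase of the numerator by
    \<open>s j\<close>. This is exactly what makes all occurrences of \<open>s j\<close> cancel
    between numerator and denominator, so that the remaining phase does not depend on j.\<close>
  define \<kappa> where "\<kappa> = cis ((\<theta> - (n - 1) * pi - sum s ?A) / 2)"
  have "poly p (cis (s j)) / (\<Prod>y\<in>?S-{cis (s j)}. cis (s j) - y) = \<kappa> * of_real ((T j - C j) / e j)"
    if j: "j \<in> ?A" for j
  proof -
    have "?S - {cis (s j)} = (\<lambda>j. cis (s j)) ` (?A - {j})"
      using inj_on_image_set_diff[OF inj, of ?A "{j}"] j by auto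
    hence "(\<Prod>y\<in>?S-{cis (s j)}. cis (s j) - y) = (\<Prod>k\<in>?A-{j}. cis (s j) - cis (s k))"
      by (simp only: prod.reindex[OF inj_on_diff[OF inj]] o_def)
    also have "\<dots> = of_real (e j) * cis (((n - 1) * (s j + pi) + (sum s ?A - s j)) / 2)"
      using j n by (simp only: prod_cis_diff e_def) (simp add: sum_diff1 of_nat_diff)
    finally have den: "(\<Prod>y\<in>?S-{cis (s j)}. cis (s j) - y) = \<dots>" .
    have num: "poly p (cis (s j)) = of_real (T j - C j) * cis ((n * s j + \<theta>) / 2) / cis (s j)"
      using poly_Q[of j] by (simp add: p nonzero_eq_divide_eq mult.commute)
    have "cis ((n * s j + \<theta>) / 2) / (cis (s j) * cis (((n - 1) * (s j + pi) + (sum s ?A - s j)) / 2)) = \<kappa>"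
      unfolding cis_mult cis_divide \<kappa>_def by (rule arg_cong[of _ _ cis]) (use n in \<open>simp add: field_simps of_nat_diff\<close>)
    moreover have "a * x / b / (d * y) = x / (b * y) * (a / d)" for a b d x y :: complex
      by (simp add: mult_ac)
    ultimately show ?thesis unfolding num den of_real_divide by metis
  qed
  hence "(\<Sum>j\<in>?A. \<kappa> * of_real ((T j - C j) / e j)) = (\<Sum>x\<in>?S. poly p x / (\<Prod>y\<in>?S-{x}. x - y))"
    by (subst sum.reindex[OF inj]) auto
  also have "\<dots> = 0"
    using sum_poly_over_node_differences[of ?S p] card_S \<open>degree p < n\<close> \<open>coeff p (n - 1) = 0\<close> by simp
  finally have "\<kappa> * of_real (\<Sum>j\<in>?A. (T j - C j) / e j) = 0"
    by (simp add: sum_distrib_left)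
  hence sum0: "(\<Sum>j\<in>?A. (T j - C j) / e j) = 0"
    unfolding \<kappa>_def by (simp del: of_real_sum of_real_divide)
  \<comment> \<open>As |\<open>T j\<close>| \<ge> 2 \<ge> |\<open>C j\<close>|, the difference
    \<open>T j - C j\<close> is zero or has the sign of \<open>T j\<close>, which is the sign of
    \<open>e j\<close>.\<close>
  have nonneg: "(T j - C j) / e j \<ge> 0" if j: "j \<in> ?A" for j
  proof -
    have "\<bar>T j\<bar> \<ge> 2"
      using large[OF j] unfolding prod_T norm_mult by simp
    moreover have "\<bar>C j\<bar> \<le> 2"
      unfolding C_def using abs_cos_le_one[of "(n * s j - \<theta>) / 2"] by (simp add: abs_mult)
    ultimately show ?thesis
      using Te[OF j] unfolding zero_less_mult_iff zero_le_divide_iff by linarith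
  qed
  have eq: "T j = C j" if j: "j \<in> ?A" for j
  proof -
    have "(T j - C j) / e j = 0"
      using sum_nonneg_eq_0_iff[of ?A "\<lambda>j. (T j - C j) / e j"] sum0 nonneg j by blast
    thus ?thesis using Te[OF j] unfolding divide_eq_0_iff by auto
  qed
  have "(\<Prod>k\<in>?A. z - cis (t k)) = z ^ card ?A - c" for z
  proof (rule poly_prod_linear_eq_power_minus)
    fix x assume "x \<in> ?S"
    then obtain j where "j \<in> ?A" "x = cis (s j)" by auto
    thus "(\<Prod>k\<in>?A. x - cis (t k)) = x ^ card ?A - c"
      using prod_T[of j] ref_C[of j] eq[of j] by (simp only: card_atLeastAtMost diff_Suc_1)
  next
    show "card ?S \<ge> card ?A" unfolding card_S by simp
  qed (use n in simp_all)
  moreover have "norm c = 1" by (simp add: c_def)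
  ultimately show ?thesis by (intro exI[of _ c]) simp
qed

section \<open>Maxima over arcs and the upper bound\<close>

lemma maximum_eqI:
  assumes "m \<in> S" "\<And>x. x \<in> S \<Longrightarrow> x \<le> m"
  shows "maximum S = m"
  unfolding maximum_def using assms by (intro Greatest_equality) auto

lemma node_mono:
  assumes "t \<in> Omega n" "1 \<le> j" "j \<le> k" "k \<le> n + 1"
  shows "node n t j \<le> node n t k"
proof -
  have mono: "t a \<le> t b" if "1 \<le> a" "a \<le> b" "b \<le> n" for a b
  proof -
    have "mono_on {1..n} t" using assms(1) by (simp add: Omega_def)
    thus ?thesis by (rule mono_onD) (use that in simp_all)
  qed
  show ?thesis
  proof (cases "k = n + 1 \<and> j \<le> n")
    \<comment> \<open>The wrap-around case: \<open>t j\<close> < 2 pi \<le>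
      \<open>t 1 + 2 * pi\<close>.\<close>
    case True
    have "t \<in> {1..n} \<rightarrow>\<^sub>E {0..<2*pi}" using assms(1) by (simp add: Omega_def)
    from PiE_mem[OF this, of j] PiE_mem[OF this, of 1] have "t j < 2 * pi" "0 \<le> t 1"
      using True assms(2) by simp_all
    thus ?thesis using True by (simp add: node_def)
  next
    case False
    hence "j = k \<or> k \<le> n" using assms by linarith
    thus ?thesis
    proof
      assume "k \<le> n"
      thus ?thesis using assms(2,3) mono[of j k] by (simp add: node_def)
    qed simp
  qed
qed

text \<open>A continuous function on a nonempty compact interval has a greatest value, so
  \<open>maximum\<close> is not unspecified here. The interval may be a single point if nodes
  coincide.\<close>

lemma arc_max_attained:
  assumes "t \<in> Omega n" "j \<in> {1..n}"
  shows "\<exists>s\<in>{node n t j..node n t (j + 1)}. arc_max n t j = norm (\<Prod>k=1..n. cis s - cis (t k))"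
proof -
  let ?I = "{node n t j..node n t (j + 1)}" and ?f = "\<lambda>s. norm (\<Prod>k=1..n. cis s - cis (t k))"
  have "?I \<noteq> {}" using node_mono[of t n j "j + 1"] assms by auto
  moreover have "continuous_on ?I ?f" by (intro continuous_intros)
  ultimately obtain s where s: "s \<in> ?I" "\<And>x. x \<in> ?I \<Longrightarrow> ?f x \<le> ?f s"
    using continuous_attains_sup[OF compact_Icc, of "node n t j" "node n t (j + 1)" ?f] by blast
  have "arc_max n t j = ?f s"
    unfolding arc_max_def by (rule maximum_eqI) (use s in blast)+
  thus ?thesis using s by blast
qed

text \<open>Every closed arc contains a point with |P| \<ge> 2. Since P vanishes at the endpoints,
  such a point lies strictly inside its arc; this yields the interlacing and also rules out
  coincident nodes.\<close>

lemma prod_eq_power_minus_if_min_arc_max_ge_2: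
  assumes n: "n \<ge> 1" and t: "t \<in> Omega n" and ge: "min_arc_max n t \<ge> 2"
  shows "\<exists>c. norm c = 1 \<and> (\<forall>z. (\<Prod>k=1..n. z - cis (t k)) = z ^ n - c)"
    and "inj_on (\<lambda>k. cis (t k)) {1..n}"
proof -
  have "\<exists>s. \<forall>j\<in>{1..n}. s j \<in> {node n t j..node n t (j + 1)} \<and>
      2 \<le> norm (\<Prod>k=1..n. cis (s j) - cis (t k))"
  proof (rule bchoice, rule ballI)
    fix j assume j: "j \<in> {1..n}"
    have "min_arc_max n t \<le> arc_max n t j" unfolding min_arc_max_def using j by simp
    thus "\<exists>s. s \<in> {node n t j..node n t (j + 1)} \<and> 2 \<le> norm (\<Prod>k=1..n. cis s - cis (t k))"
      using arc_max_attained[OF t j] ge by (metis order_trans)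
  qed
  then obtain s where s: "\<And>j. j \<in> {1..n} \<Longrightarrow> s j \<in> {node n t j..node n t (j + 1)}"
    and large: "\<And>j. j \<in> {1..n} \<Longrightarrow> 2 \<le> norm (\<Prod>k=1..n. cis (s j) - cis (t k))" by blast
  have range: "0 \<le> t j" "t j < 2 * pi" if "j \<in> {1..n}" for j
    using t that by (auto simp: Omega_def PiE_iff)
  have strict: "node n t j < s j" "s j < node n t (j + 1)" if j: "j \<in> {1..n}" for j
  proof -
    have "s j \<noteq> node n t k" if k: "k \<in> {1..n+1}" for k
    proof
      assume "s j = node n t k"
      \<comment> \<open>The extra node \<open>t 1 + 2 * pi\<close> gives the same point of the
        circle as \<open>t 1\<close>, so it too is a zero of P.\<close>
      moreover have "\<exists>m\<in>{1..n}. cis (node n t k) = cis (t m)"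
        using k n by (cases "k = n + 1") (auto simp: node_def cis_mult[symmetric])
      ultimately have "\<exists>m\<in>{1..n}. cis (s j) - cis (t m) = 0" by simp
      hence "(\<Prod>k=1..n. cis (s j) - cis (t k)) = 0" by (intro prod_zero) simp_all
      thus False using large[OF j] by (simp only: norm_zero)
    qed
    hence "s j \<noteq> node n t j" "s j \<noteq> node n t (j + 1)" using j by simp_all
    thus "node n t j < s j" "s j < node n t (j + 1)"
      using s[OF j] unfolding atLeastAtMost_iff by linarith+
  qed
  have node: "node n t j = t j" if "j \<in> {1..n}" for j using that by (simp add: node_def)
  have upper: "s j < t 1 + 2 * pi" "t 1 \<le> t j" if j: "j \<in> {1..n}" for j
  proof -
    have "s j < node n t (n + 1)"
      using strict(2)[OF j] node_mono[OF t, of "j + 1" "n + 1"] j by auto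
    thus "s j < t 1 + 2 * pi" by (simp add: node_def)
    show "t 1 \<le> t j" using node_mono[OF t, of 1 j] j n by (simp add: node)
  qed
  have step: "s k < t j" if "j \<in> {1..n}" "k \<in> {1..n}" "k < j" for j k
  proof -
    have "node n t (k + 1) \<le> node n t j" using that by (intro node_mono[OF t]) simp_all
    thus ?thesis using strict(2)[OF that(2)] node[OF that(1)] by linarith
  qed
  show "\<exists>c. norm c = 1 \<and> (\<forall>z. (\<Prod>k=1..n. z - cis (t k)) = z ^ n - c)"
  proof (rule prod_eq_power_minus_if_interlacing[OF n _ _ large])
    fix j assume j: "j \<in> {1..n}"
    show "t j < s j \<and> s j < t j + 2 * pi" using strict(1)[OF j] node[OF j] upper[OF j] by simp
  next
    fix j k assume jk: "j \<in> {1..n}" "k \<in> {1..n}" "k < j"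
    show "t k < s j \<and> s j < t k + 2 * pi \<and> s k < s j \<and> s j < s k + 2 * pi \<and> s k < t j \<and> t j < s k + 2 * pi"
      using step[OF jk] strict(1)[OF jk(1)] strict(1)[OF jk(2)] node[OF jk(1)] node[OF jk(2)]
        upper[OF jk(1)] upper[OF jk(2)] by linarith
  qed
  have less: "t k < t j" if "j \<in> {1..n}" "k \<in> {1..n}" "k < j" for j k
    using step[OF that] strict(1)[OF that(2)] node[OF that(2)] by linarith
  have neq: "cis (t j) \<noteq> cis (t k)" if "j \<in> {1..n}" "k \<in> {1..n}" "k < j" for j k
  proof -
    have "sin ((t j - t k) / 2) > 0"
      using less[OF that] range[OF that(1)] range[OF that(2)] by (intro sin_gt_zero) auto
    hence "cis (t j) - cis (t k) \<noteq> 0" by (simp add: cis_diff)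
    thus ?thesis by simp
  qed
  show "inj_on (\<lambda>k. cis (t k)) {1..n}"
    by (rule inj_onI, rule ccontr) (use neq in \<open>metis linorder_neqE_nat\<close>)
qed

text \<open>A larger value would force P(z) = z^n - c with |c| = 1, but that polynomial has modulus
  at most 2 on the circle.\<close>

lemma min_arc_max_le_2:
  assumes n: "n \<ge> 1" and t: "t \<in> Omega n"
  shows "min_arc_max n t \<le> 2"
proof (rule ccontr)
  assume "\<not> ?thesis"
  hence gt: "min_arc_max n t > 2" by simp
  then obtain c where c: "norm c = 1" "\<And>z. (\<Prod>k=1..n. z - cis (t k)) = z ^ n - c"
    using prod_eq_power_minus_if_min_arc_max_ge_2(1)[OF n t] by auto
  have j: "1 \<in> {1..n}" using n by simp
  obtain s where "arc_max n t 1 = norm (\<Prod>k=1..n. cis s - cis (t k))"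
    using arc_max_attained[OF t j] by blast
  also have "\<dots> \<le> norm (cis s ^ n) + norm c" unfolding c(2) by (rule norm_triangle_ineq4)
  also have "\<dots> = 2" by (simp add: c(1) norm_power)
  also have "min_arc_max n t \<le> arc_max n t 1" unfolding min_arc_max_def using j by simp
  finally show False using gt by simp
qed

section \<open>Equally spaced points as n-th roots\<close>

text \<open>By counting, n distinct roots of w^n = c are all of them, and these form the set of n-th
  roots of unity rotated by one fixed root \<open>cis a\<close>.\<close>

lemma distinct_equally_spaced_if_roots:
  assumes n: "n \<ge> 1" and inj: "inj_on z {1..n}" and c: "norm c = 1"
    and roots: "\<And>k. k \<in> {1..n} \<Longrightarrow> z k ^ n = c"
  shows "distinct_equally_spaced n z"
proof -
  define a where "a = Arg c / n"
  define f where "f k = cis (a + 2 * pi * real k / real n)" for k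
  have "cis a ^ n = c"
    using n c cis_Arg[of c] by (cases "c = 0") (simp_all add: a_def Complex.DeMoivre sgn_div_norm)
  hence a: "w ^ n = c \<longleftrightarrow> (w / cis a) ^ n = 1" for w
    by (auto simp: power_divide)
  have "w \<in> f ` {1..n} \<longleftrightarrow> w ^ n = c" for w
  proof
    assume "w \<in> f ` {1..n}"
    then obtain k where "w = cis a * cis (2 * pi * real k / real n)"
      by (auto simp: f_def cis_mult)
    moreover have "cis (2 * pi * real k / real n) ^ n = 1"
      using n by (simp add: Complex.DeMoivre)
    ultimately show "w ^ n = c" using a[of w] by simp
  next
    assume "w ^ n = c"
    then obtain k where "k < n" "w / cis a = cis (2 * pi * real k / real n)"
      using a[of w] Complex.bij_betw_roots_unity[of n] n unfolding bij_betw_def by force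
    hence k: "k < n" "w = f k" by (auto simp: f_def divide_eq_eq cis_mult add.commute)
    show "w \<in> f ` {1..n}"
    \<comment> \<open>The roots of unity are indexed from 0 to n - 1, the points of the definition
      from 1 to n; index 0 is replaced by n.\<close>
    proof (cases "k = 0")
      case True
      have "f 0 = f n" using n by (simp add: f_def flip: cis_mult)
      thus ?thesis using k True n by auto
    qed (use k in auto)
  qed
  hence f: "f ` {1..n} = {w. w ^ n = c}" by blast
  have "z ` {1..n} = {w. w ^ n = c}"
  proof (rule card_subset_eq)
    show "card (z ` {1..n}) = card {w. w ^ n = c}"
      using n c inj by (subst card_nth_roots) (auto simp: card_image)
  qed (use roots n in auto)
  thus ?thesis unfolding distinct_equally_spaced_def using inj f unfolding f_def by blast
qed

text \<open>This is the witness that the value 2 is attained. The shift \<open>k - 1\<close> starts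
  the angles at 0 and keeps the last one below 2 pi; \<open>restrict\<close> makes \<open>t\<close>
  extensional, as \<open>Omega\<close> demands.\<close>

lemma min_arc_max_roots_of_unity:
  assumes n: "n \<ge> 1"
  defines "t \<equiv> restrict (\<lambda>k. 2 * pi * real (k - 1) / real n) {1..n}"
  shows "t \<in> Omega n" and "min_arc_max n t = 2"
proof -
  show t: "t \<in> Omega n"
    unfolding Omega_def
  proof (intro CollectI conjI PiE_I mono_onI)
    fix k assume "k \<in> {1..n}"
    hence "real (k - 1) / n < 1" using n by (simp add: divide_simps)
    hence "2 * pi * (real (k - 1) / n) < 2 * pi * 1"
      by (intro mult_strict_left_mono) simp_all
    thus "t k \<in> {0..<2 * pi}" using \<open>k \<in> {1..n}\<close> by (simp add: t_def)
  next
    fix k l assume "k \<in> {1..n}" "l \<in> {1..n}" "k \<le> l"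
    thus "t k \<le> t l" by (simp add: t_def divide_right_mono)
  next
    fix k assume "k \<notin> {1..n}"
    thus "t k = undefined" by (simp only: t_def restrict_def if_False)
  qed
  have t_eq: "t k = 2 * pi * real (k - 1) / real n" if "k \<in> {1..n}" for k
    using that by (simp add: t_def)
  have "bij_betw (\<lambda>k. cis (t k)) {1..n} {z. z ^ n = 1}"
  proof -
    have "bij_betw (\<lambda>k. k - 1) {1..n} {..<n}"
      by (rule bij_betw_byWitness[where f' = Suc]) auto
    hence "bij_betw ((\<lambda>k. cis (2 * pi * real k / real n)) \<circ> (\<lambda>k. k - 1)) {1..n} {z. z ^ n = 1}"
      using Complex.bij_betw_roots_unity[of n] n by (intro bij_betw_trans) simp_all
    thus ?thesis by (rule bij_betw_cong[THEN iffD1, rotated]) (simp add: t_eq)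
  qed
  hence image: "(\<lambda>k. cis (t k)) ` {1..n} = {z. z ^ n = 1}" by (simp add: bij_betw_def)
  have "(\<Prod>k\<in>{1..n}. z - cis (t k)) = z ^ card {1..n} - 1" for z
  proof (rule poly_prod_linear_eq_power_minus)
    fix x :: complex assume "x \<in> {z. z ^ n = 1}"
    moreover from this have "(\<Prod>k\<in>{1..n}. x - cis (t k)) = 0"
      unfolding image[symmetric] by (intro prod_zero) auto
    ultimately show "(\<Prod>k\<in>{1..n}. x - cis (t k)) = x ^ card {1..n} - 1" by simp
  qed (use n card_roots_unity_eq[of n] in simp_all)
  hence prod: "(\<Prod>k=1..n. z - cis (t k)) = z ^ n - 1" for z by simp
  have "arc_max n t j = 2" if j: "j \<in> {1..n}" for j
    unfolding arc_max_def prod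
  proof (rule maximum_eqI)
    \<comment> \<open>The midpoint of the j-th arc, where z^n = -1 and hence |z^n - 1| = 2.\<close>
    define s where "s = (pi + 2 * pi * real (j - 1)) / n"
    have "n * s = pi + 2 * pi * real (j - 1)"
      using n by (simp add: s_def)
    hence "cis s ^ n = cis pi * cis (2 * pi * real (j - 1))"
      by (simp only: Complex.DeMoivre cis_mult)
    hence "norm (cis s ^ n - 1) = 2" by simp
    moreover have "s \<in> {node n t j..node n t (j + 1)}"
    proof -
      have "node n t j = 2 * pi * real (j - 1) / n"
        using j by (simp add: node_def t_eq)
      \<comment> \<open>For j = n the node is \<open>t 1 + 2 * pi\<close> with \<open>t 1\<close> =
        0, which fits the same formula.\<close>
      moreover have "node n t (j + 1) = 2 * pi * real j / n"
        using j n by (cases "j = n") (simp_all add: node_def t_eq)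
      moreover have "2 * pi * real j = 2 * pi * real (j - 1) + 2 * pi"
        using j by (simp add: of_nat_diff algebra_simps)
      ultimately show ?thesis
        by (simp add: s_def divide_right_mono)
    qed
    ultimately show "2 \<in> (\<lambda>s. norm (cis s ^ n - 1)) ` {node n t j..node n t (j + 1)}"
      by (intro image_eqI[of _ _ s]) simp_all
  next
    fix x assume "x \<in> (\<lambda>s. norm (cis s ^ n - 1)) ` {node n t j..node n t (j + 1)}"
    then obtain s where "x = norm (cis s ^ n - 1)" by auto
    thus "x \<le> 2" using norm_triangle_ineq4[of "cis s ^ n" 1] by (simp add: norm_power)
  qed
  hence "arc_max n t ` {1..n} = (\<lambda>_. 2) ` {1..n}" by (rule image_cong[OF refl])
  also have "\<dots> = {2}" using n by (intro image_constant[of 1]) simp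
  finally have "arc_max n t ` {1..n} = {2}" .
  thus "min_arc_max n t = 2" by (simp add: min_arc_max_def)
qed

section \<open>The extremal value and its maximizers\<close>

theorem corollary1p2:
  fixes n :: nat
  assumes "n \<ge> 1"
  shows "(\<exists>t\<in>Omega n. min_arc_max n t = m_star n) \<and>
         (\<forall>t\<in>Omega n. min_arc_max n t \<le> m_star n) \<and>
         m_star n = 2 \<and>
         (\<forall>t\<in>Omega n. min_arc_max n t = m_star n \<longrightarrow>
            distinct_equally_spaced n (\<lambda>k. cis (t k)))"
proof -
  note roots = min_arc_max_roots_of_unity[OF assms]
  have m: "m_star n = 2"
    unfolding m_star_def
  proof (rule maximum_eqI)
    show "2 \<in> min_arc_max n ` Omega n" using roots by (intro image_eqI[OF sym])
  qed (use min_arc_max_le_2[OF assms] in blast)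
  have "distinct_equally_spaced n (\<lambda>k. cis (t k))" if t: "t \<in> Omega n" "min_arc_max n t = 2" for t
  proof -
    have ge: "min_arc_max n t \<ge> 2" using t by simp
    obtain c where c: "norm c = 1" "\<And>z. (\<Prod>k=1..n. z - cis (t k)) = z ^ n - c"
      using prod_eq_power_minus_if_min_arc_max_ge_2(1)[OF assms t(1) ge] by auto
    have "cis (t k) ^ n = c" if "k \<in> {1..n}" for k
    proof -
      \<comment> \<open>Evaluating P(z) = z^n - c at its own zero z_k gives z_k^n = c.\<close>
      have "(\<Prod>m=1..n. cis (t k) - cis (t m)) = 0" using that by (intro prod_zero) auto
      thus ?thesis unfolding c(2) by simp
    qed
    thus ?thesis
      using prod_eq_power_minus_if_min_arc_max_ge_2(2)[OF assms t(1) ge] c(1)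
      by (intro distinct_equally_spaced_if_roots[OF assms]) auto
  qed
  thus ?thesis unfolding m using min_arc_max_le_2[OF assms] roots by blast
qed

end
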